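(* For every $\varepsilon>0$, every randomized online algorithm for online decomposable weighted bipartite matching with free disposal (defined in the context) has competitive ratio at most $0.8+\varepsilon$ against an oblivious adversary; that is, there is an instance (fixed in advance, independent of the algorithm's random choices) on which the algorithm's expected value is at most $(0.8+\varepsilon)\mathrm{OPT}$.
   Context: Problem (online decomposable weighted bipartite matching with free disposal). A finite set $V_1$ of machines with speeds $s:V_1\to\mathbb{R}_{>0}$ is known in advance. Jobs $v$ with sizes $w(v)>0$ arrive one at a time; when $v$ arrives, $w(v)$ is revealed and the algorithm must immediately and irrevocably assign $v$ to a machine (any job may go to any machine; a machine may receive several jobs). At the end, each machine $u$ earns $s(u)$ times the maximum size of a job assigned to it (0 if none); the algorithm's value is the sum of these earnings. $\mathrm{OPT}$ is the maximum value over all offline assignments. The competitive ratio of a randomized algorithm is the infimum over instances of (its expected value)/$\mathrm{OPT}$. *)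

theory Defs
  imports "HOL-Probability.Probability"
begin

text \<open>
  An instance is given by the machines \<open>V\<close>, their speeds \<open>s\<close> and the sizes \<open>ws\<close> of the jobs in
  order of arrival; job \<open>i < length ws\<close> has size \<open>ws ! i\<close>.  Requiring a machine and a job rules
  out exactly the degenerate instances whose optimum is 0, for which the ratio to the optimum is
  meaningless and any bound against it would hold trivially.
\<close>

definition machine_park :: "'m set \<Rightarrow> ('m \<Rightarrow> real) \<Rightarrow> bool" where
  "machine_park V s \<longleftrightarrow> finite V \<and> V \<noteq> {} \<and> (\<forall>u\<in>V. s u > 0)"

definition job_sequence :: "real list \<Rightarrow> bool" where
  "job_sequence ws \<longleftrightarrow> ws \<noteq> [] \<and> (\<forall>w\<in>set ws. w > 0)"

definition jobs_on :: "real list \<Rightarrow> (nat \<Rightarrow> 'm) \<Rightarrow> 'm \<Rightarrow> nat set" where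
  "jobs_on ws f u = {i. i < length ws \<and> f i = u}"

definition earning :: "('m \<Rightarrow> real) \<Rightarrow> real list \<Rightarrow> (nat \<Rightarrow> 'm) \<Rightarrow> 'm \<Rightarrow> real" where
  "earning s ws f u =
     (if jobs_on ws f u = {} then 0 else s u * Max ((\<lambda>i. ws ! i) ` jobs_on ws f u))"

definition assignment_value :: "'m set \<Rightarrow> ('m \<Rightarrow> real) \<Rightarrow> real list \<Rightarrow> (nat \<Rightarrow> 'm) \<Rightarrow> real" where
  "assignment_value V s ws f = (\<Sum>u\<in>V. earning s ws f u)"

definition OPT :: "'m set \<Rightarrow> ('m \<Rightarrow> real) \<Rightarrow> real list \<Rightarrow> real" where
  "OPT V s ws = Max (assignment_value V s ws ` ({..<length ws} \<rightarrow>\<^sub>E V))"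

text \<open>
  A deterministic online algorithm sees the machines and speeds and the list of sizes of the jobs
  that have arrived so far, the newest one last, and names the machine for the newest job.
  Its own earlier decisions are determined by these data.
\<close>

type_synonym 'm online_algorithm = "'m set \<Rightarrow> ('m \<Rightarrow> real) \<Rightarrow> real list \<Rightarrow> 'm"

definition online_assignment ::
    "'m online_algorithm \<Rightarrow> 'm set \<Rightarrow> ('m \<Rightarrow> real) \<Rightarrow> real list \<Rightarrow> nat \<Rightarrow> 'm" where
  "online_assignment A V s ws i = A V s (take (Suc i) ws)"

text \<open>
  A randomized online algorithm draws a random seed \<open>\<omega>\<close> from an arbitrary probability space and
  then runs the deterministic algorithm \<open>A \<omega>\<close>.  Measurability into \<open>count_space V\<close> includes that
  every decision is a machine in \<open>V\<close>.
\<close>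

definition randomized_online_algorithm ::
    "'r measure \<Rightarrow> ('r \<Rightarrow> 'm online_algorithm) \<Rightarrow> bool" where
  "randomized_online_algorithm M A \<longleftrightarrow>
     prob_space M \<and>
     (\<forall>V s ws. machine_park V s \<longrightarrow> job_sequence ws \<longrightarrow>
        (\<lambda>\<omega>. A \<omega> V s ws) \<in> M \<rightarrow>\<^sub>M count_space V)"

definition expected_value ::
    "'r measure \<Rightarrow> ('r \<Rightarrow> 'm online_algorithm) \<Rightarrow>
     'm set \<Rightarrow> ('m \<Rightarrow> real) \<Rightarrow> real list \<Rightarrow> real" where
  "expected_value M A V s ws =
     (\<integral>\<omega>. assignment_value V s ws (online_assignment (A \<omega>) V s ws) \<partial>M)"

definition competitive_ratio :: "'r measure \<Rightarrow> ('r \<Rightarrow> 'm online_algorithm) \<Rightarrow> real" where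
  "competitive_ratio M A =
     Inf {expected_value M A V s ws / OPT V s ws | V s ws. machine_park V s \<and> job_sequence ws}"

end

theory Submission
  imports Defs
begin

text \<open>
  Yao's principle with one machine of speed 4, many machines of speed 1, and jobs of sizes
  \<open>1, 2, 4, \<dots>\<close>, stopped after the job of size \<open>2 ^ m\<close> with probability proportional to \<open>2 ^ - m\<close>.
  Divided by \<open>2 ^ m\<close>, the optimum is \<open>5 - 2 ^ - m\<close>: the last job goes to the fast machine and the
  others to slow machines of their own.  An online algorithm pays for each use of the fast machine
  by overwriting the job it held, and otherwise leaves it with a job of at most half the current
  size.  Taking the normalized earnings of the slow machines as a potential, the normalized value
  is at most 4 per step, amortized.
\<close>

section \<open>Earnings and the optimum on arbitrary instances\<close>

lemma earning_nonneg:
  assumes "\<forall>w\<in>set ws. w > 0" "s u > 0"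
  shows "earning s ws f u \<ge> 0"
proof (cases "jobs_on ws f u = {}")
  case False
  have "finite (jobs_on ws f u)" by (simp add: jobs_on_def)
  then have "Max ((!) ws ` jobs_on ws f u) \<in> (!) ws ` jobs_on ws f u"
    using False by (intro Max_in) auto
  then have "Max ((!) ws ` jobs_on ws f u) > 0"
    using assms(1) by (auto simp: jobs_on_def)
  then show ?thesis using assms(2) False by (simp add: earning_def)
qed (simp add: earning_def)

lemma assignment_value_nonneg:
  assumes "machine_park V s" "\<forall>w\<in>set ws. w > 0"
  shows "assignment_value V s ws f \<ge> 0"
  using assms unfolding assignment_value_def machine_park_def
  by (intro sum_nonneg earning_nonneg) auto

lemma earning_cong:
  assumes "\<And>i. i < length ws \<Longrightarrow> f i = g i"
  shows "earning s ws f u = earning s ws g u"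
proof -
  have "jobs_on ws f u = jobs_on ws g u" using assms by (auto simp: jobs_on_def)
  then show ?thesis by (simp add: earning_def)
qed

text \<open>A job at least as large as all earlier ones makes the older jobs on its machine
  irrelevant, so the maximum becomes a plain overwrite. Later arguments can then recurse on the
  number of jobs.\<close>

lemma earning_append_largest:
  assumes "\<forall>v\<in>set ws. v \<le> w"
  shows "earning s (ws @ [w]) f u = (if f (length ws) = u then s u * w else earning s ws f u)"
proof (cases "f (length ws) = u")
  case True
  have jobs: "jobs_on (ws @ [w]) f u = insert (length ws) (jobs_on ws f u)"
    using True by (auto simp: jobs_on_def)
  have "Max ((!) (ws @ [w]) ` jobs_on (ws @ [w]) f u) = w"
  proof (rule Max_eqI)
    show "finite ((!) (ws @ [w]) ` jobs_on (ws @ [w]) f u)" by (simp add: jobs_on_def)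
    show "w \<in> (!) (ws @ [w]) ` jobs_on (ws @ [w]) f u" by (simp add: jobs)
    show "y \<le> w" if "y \<in> (!) (ws @ [w]) ` jobs_on (ws @ [w]) f u" for y
      using that assms by (auto simp: jobs jobs_on_def nth_append)
  qed
  then show ?thesis using True by (simp add: earning_def jobs)
next
  case False
  have jobs: "jobs_on (ws @ [w]) f u = jobs_on ws f u"
    using False by (auto simp: jobs_on_def less_Suc_eq)
  have "(!) (ws @ [w]) ` jobs_on ws f u = (!) ws ` jobs_on ws f u"
    by (intro image_cong) (auto simp: jobs_on_def nth_append)
  then show ?thesis using False by (simp add: earning_def jobs)
qed

lemma OPT_ge_assignment_value:
  assumes "finite V" "f \<in> {..<length ws} \<rightarrow> V"
  shows "assignment_value V s ws f \<le> OPT V s ws"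
proof -
  let ?g = "restrict f {..<length ws}"
  have "assignment_value V s ws f = assignment_value V s ws ?g"
    unfolding assignment_value_def by (intro sum.cong refl earning_cong) auto
  also have "\<dots> \<le> OPT V s ws"
    unfolding OPT_def using assms by (intro Max_ge) (auto intro!: finite_PiE)
  finally show ?thesis .
qed

lemma OPT_nonneg:
  assumes "machine_park V s" "\<forall>w\<in>set ws. w > 0"
  shows "OPT V s ws \<ge> 0"
proof -
  obtain u where "u \<in> V" using assms(1) by (auto simp: machine_park_def)
  then have "assignment_value V s ws (\<lambda>_. u) \<le> OPT V s ws"
    using assms(1) by (intro OPT_ge_assignment_value) (auto simp: machine_park_def)
  then show ?thesis using assignment_value_nonneg[OF assms, of "\<lambda>_. u"] by linarith
qed

section \<open>The doubling instance: its optimum and the value of a fixed assignment\<close>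

definition doubling_jobs :: "nat \<Rightarrow> real list" where
  "doubling_jobs k = map (\<lambda>i. 2 ^ i) [0..<k]"

text \<open>Speed 4 balances the two decisions for a new job: the fast machine gives a normalized 4;
  a slow one gives 1 now and at most 1 over all later steps, with at most 2 left on the fast
  machine.\<close>

definition speeds :: "nat \<Rightarrow> real" where
  "speeds u = (if u = 0 then 4 else 1)"

lemma length_doubling_jobs [simp]: "length (doubling_jobs k) = k"
  by (simp add: doubling_jobs_def)

lemma doubling_jobs_0 [simp]: "doubling_jobs 0 = []"
  by (simp add: doubling_jobs_def)

lemma doubling_jobs_pos: "\<forall>w\<in>set (doubling_jobs k). w > 0"
  by (simp add: doubling_jobs_def)

lemma job_sequence_doubling_jobs: "job_sequence (doubling_jobs (Suc k))"
  using doubling_jobs_pos[of "Suc k"] by (auto simp: job_sequence_def doubling_jobs_def)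

lemma take_doubling_jobs: "i \<le> k \<Longrightarrow> take i (doubling_jobs k) = doubling_jobs i"
  by (simp add: doubling_jobs_def take_map)

lemma machine_park_speeds: "machine_park {..n} speeds"
  by (auto simp: machine_park_def speeds_def)

lemma earning_Nil [simp]: "earning s [] f u = 0"
  by (simp add: earning_def jobs_on_def)

lemma earning_doubling_jobs_Suc:
  "earning s (doubling_jobs (Suc k)) f u =
     (if f k = u then s u * 2 ^ k else earning s (doubling_jobs k) f u)"
proof -
  have "doubling_jobs (Suc k) = doubling_jobs k @ [2 ^ k]"
    by (simp add: doubling_jobs_def)
  moreover have "\<forall>v\<in>set (doubling_jobs k). v \<le> 2 ^ k"
    by (auto simp: doubling_jobs_def intro!: power_increasing)
  ultimately show ?thesis using earning_append_largest[of "doubling_jobs k" "2 ^ k" s f u] by simp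
qed

lemma earning_doubling_jobs_le:
  assumes "s u \<ge> 0"
  shows "2 * earning s (doubling_jobs k) f u \<le> s u * 2 ^ k"
proof (induction k)
  case (Suc k)
  moreover have "s u * 2 ^ k \<ge> 0" using assms by simp
  ultimately show ?case
    by (auto simp: earning_doubling_jobs_Suc)
qed (use assms in simp)

lemma OPT_doubling_jobs_ge:
  assumes "m \<le> n"
  shows "OPT {..n} speeds (doubling_jobs (Suc m)) \<ge> 5 * 2 ^ m - 1"
proof -
  let ?ws = "doubling_jobs (Suc m)"
  \<comment> \<open>The largest job \<open>m\<close> takes the fast machine; each job
    \<open>i < m\<close> has the slow machine \<open>Suc i\<close> to itself, which exists because
    \<open>m \<le> n\<close>.\<close>
  let ?f = "\<lambda>i. if i = m then 0 else Suc i"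
  have slow: "earning speeds (doubling_jobs k) ?f (Suc i) = 2 ^ i" if "i < k" "i < m" for i k
    using that by (induction k) (auto simp: earning_doubling_jobs_Suc speeds_def less_Suc_eq)
  have "5 * 2 ^ m - 1 = 4 * 2 ^ m + (\<Sum>i<m. 2 ^ i :: real)"
    by (simp add: sum_gp_strict)
  also have "\<dots> = earning speeds ?ws ?f 0 + (\<Sum>i<m. earning speeds ?ws ?f (Suc i))"
    using slow[of _ "Suc m"] by (simp add: earning_doubling_jobs_Suc speeds_def)
  also have "\<dots> = (\<Sum>u\<in>{..m}. earning speeds ?ws ?f u)"
    by (simp add: sum.atMost_shift)
  also have "\<dots> \<le> assignment_value {..n} speeds ?ws ?f"
    unfolding assignment_value_def using assms doubling_jobs_pos
    by (intro sum_mono2 earning_nonneg) (auto simp: speeds_def)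
  also have "\<dots> \<le> OPT {..n} speeds ?ws"
    using assms by (intro OPT_ge_assignment_value) (auto simp: less_Suc_eq)
  finally show ?thesis .
qed

text \<open>If r is the slow earning after \<open>k\<close> jobs, the second term is the sum of r /
  2 ^ j over all j \<ge> k: all that the jobs now held by slow machines can still contribute. The
  future of a slow job is thus charged when the job is placed.\<close>

lemma assignment_value_doubling_jobs_amortized:
  assumes "\<And>i. i < k \<Longrightarrow> f i \<le> n"
  shows "(\<Sum>j<k. assignment_value {..n} speeds (doubling_jobs (Suc j)) f / 2 ^ j)
    + 2 * (\<Sum>u\<in>{1..n}. earning speeds (doubling_jobs k) f u) / 2 ^ k \<le> 4 * real k"
  using assms
proof (induction k)
  case (Suc k)
  define e where "e j = earning speeds (doubling_jobs j) f 0" for j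
  define r where "r j = (\<Sum>u\<in>{1..n}. earning speeds (doubling_jobs j) f u)" for j
  have value_eq: "assignment_value {..n} speeds (doubling_jobs j) f = e j + r j" for j
  proof -
    have "{..n} = insert 0 {1..n}" by auto
    then show ?thesis by (simp add: assignment_value_def e_def r_def)
  qed
  have "(e (Suc k) + r (Suc k)) / 2 ^ k + 2 * r (Suc k) / 2 ^ Suc k \<le> 4 + 2 * r k / 2 ^ k"
  proof (cases "f k = 0")
    case True
    then have "e (Suc k) = 4 * 2 ^ k" "r (Suc k) = r k"
      by (auto simp: e_def r_def earning_doubling_jobs_Suc speeds_def intro!: sum.cong)
    then show ?thesis by (simp add: field_simps)
  next
    case False
    \<comment> \<open>Overwriting loses the old job of the chosen machine; counting it as still
      earned gives an upper bound.\<close>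
    have "r (Suc k) \<le> (\<Sum>u\<in>{1..n}. earning speeds (doubling_jobs k) f u
        + (if f k = u then 2 ^ k else 0))"
      unfolding r_def using earning_nonneg[OF doubling_jobs_pos, of speeds]
      by (intro sum_mono) (simp add: earning_doubling_jobs_Suc speeds_def)
    also have "\<dots> = r k + 2 ^ k"
      using False Suc.prems[of k] by (simp add: r_def sum.distrib)
    finally have "r (Suc k) \<le> r k + 2 ^ k" .
    moreover have "e (Suc k) \<le> 2 * 2 ^ k"
      using False earning_doubling_jobs_le[of speeds 0 k f]
      by (simp add: e_def earning_doubling_jobs_Suc speeds_def)
    \<comment> \<open>The new potential is \<open>r (Suc k) / 2 ^ k\<close>, so the slow earnings
      count twice.\<close>
    ultimately have "(e (Suc k) + 2 * r (Suc k)) / 2 ^ k \<le> (4 * 2 ^ k + 2 * r k) / 2 ^ k"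
      by (intro divide_right_mono) auto
    then show ?thesis by (simp add: add_divide_distrib)
  qed
  moreover have "(\<Sum>j<k. (e (Suc j) + r (Suc j)) / 2 ^ j) + 2 * r k / 2 ^ k \<le> 4 * real k"
    using Suc unfolding value_eq r_def[symmetric] by simp
  ultimately show ?case unfolding value_eq r_def[symmetric] by simp
qed simp

section \<open>Expectation over the random seed\<close>

lemma integrable_earning_doubling_jobs:
  assumes "prob_space M"
    and meas: "\<And>i. (\<lambda>\<omega>. f \<omega> i) \<in> M \<rightarrow>\<^sub>M count_space V"
    and "u \<in> V" "s u > 0"
  shows "integrable M (\<lambda>\<omega>. earning s (doubling_jobs k) (f \<omega>) u)"
proof -
  interpret prob_space M by fact
  show ?thesis
  proof (rule integrable_const_bound[where B = "s u * 2 ^ k"])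
    show "AE \<omega> in M. norm (earning s (doubling_jobs k) (f \<omega>) u) \<le> s u * 2 ^ k"
    proof (intro AE_I2)
      fix \<omega>
      have "earning s (doubling_jobs k) (f \<omega>) u \<ge> 0"
        using assms by (intro earning_nonneg doubling_jobs_pos)
      moreover have "2 * earning s (doubling_jobs k) (f \<omega>) u \<le> s u * 2 ^ k"
        using assms by (intro earning_doubling_jobs_le) simp
      ultimately show "norm (earning s (doubling_jobs k) (f \<omega>) u) \<le> s u * 2 ^ k" by simp
    qed
    \<comment> \<open>The overwrite recursion reduces measurability to the events
      \<open>f \<omega> i = u\<close>, avoiding a maximum over a random set of jobs.\<close>
    show "(\<lambda>\<omega>. earning s (doubling_jobs k) (f \<omega>) u) \<in> borel_measurable M"
    proof (induction k)
      case (Suc k)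
      have "{\<omega> \<in> space M. f \<omega> k = u} = (\<lambda>\<omega>. f \<omega> k) -` {u} \<inter> space M" by auto
      also have "\<dots> \<in> sets M" using meas[of k] \<open>u \<in> V\<close> by (intro measurable_sets) auto
      finally show ?case unfolding earning_doubling_jobs_Suc
        using Suc by (intro measurable_If) auto
    qed simp
  qed
qed

lemma expected_value_doubling_jobs_sum:
  fixes A :: "'r \<Rightarrow> nat online_algorithm"
  assumes "randomized_online_algorithm M A"
  shows "(\<Sum>j<k. expected_value M A {..n} speeds (doubling_jobs (Suc j)) / 2 ^ j) \<le> 4 * real k"
proof -
  interpret prob_space M using assms by (simp add: randomized_online_algorithm_def)
  \<comment> \<open>An online decision sees only a prefix, and all the instances are prefixes of one
    sequence. Hence a single \<open>f \<omega>\<close> describes the run on each of them, and the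
    amortized bound applies to their sum for every seed.\<close>
  define f where "f \<omega> i = A \<omega> {..n} speeds (doubling_jobs (Suc i))" for \<omega> i
  define v where "v j \<omega> = assignment_value {..n} speeds (doubling_jobs (Suc j)) (f \<omega>)" for j \<omega>
  have meas: "(\<lambda>\<omega>. f \<omega> i) \<in> M \<rightarrow>\<^sub>M count_space {..n}" for i
    using assms machine_park_speeds job_sequence_doubling_jobs
    by (simp add: f_def randomized_online_algorithm_def)
  have int: "integrable M (v j)" for j
    unfolding v_def assignment_value_def using meas prob_space_axioms
    by (intro Bochner_Integration.integrable_sum integrable_earning_doubling_jobs)
      (auto simp: speeds_def)
  have "expected_value M A {..n} speeds (doubling_jobs (Suc j)) = (\<integral>\<omega>. v j \<omega> \<partial>M)" for j
    unfolding expected_value_def v_def assignment_value_def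
    by (intro Bochner_Integration.integral_cong sum.cong earning_cong refl)
      (simp add: online_assignment_def f_def take_doubling_jobs)
  then have "(\<Sum>j<k. expected_value M A {..n} speeds (doubling_jobs (Suc j)) / 2 ^ j)
      = (\<integral>\<omega>. (\<Sum>j<k. v j \<omega> / 2 ^ j) \<partial>M)"
    using int by simp
  also have "\<dots> \<le> (\<integral>\<omega>. 4 * real k \<partial>M)"
  proof (rule integral_mono)
    fix \<omega> assume "\<omega> \<in> space M"
    then have "f \<omega> i \<le> n" for i using measurable_space[OF meas, of \<omega> i] by simp
    then have "(\<Sum>j<k. v j \<omega> / 2 ^ j)
        + 2 * (\<Sum>u\<in>{1..n}. earning speeds (doubling_jobs k) (f \<omega>) u) / 2 ^ k \<le> 4 * real k"
      unfolding v_def by (intro assignment_value_doubling_jobs_amortized)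
    moreover have "(\<Sum>u\<in>{1..n}. earning speeds (doubling_jobs k) (f \<omega>) u) \<ge> 0"
      by (intro sum_nonneg earning_nonneg doubling_jobs_pos) (simp add: speeds_def)
    then have "2 * (\<Sum>u\<in>{1..n}. earning speeds (doubling_jobs k) (f \<omega>) u) / 2 ^ k \<ge> 0" by simp
    ultimately show "(\<Sum>j<k. v j \<omega> / 2 ^ j) \<le> 4 * real k" by linarith
  qed (use int in simp_all)
  finally show ?thesis by (simp add: prob_space)
qed

section \<open>Averaging over the stopping times, and the ratio\<close>

lemma OPT_doubling_jobs_sum:
  assumes "k \<le> Suc n"
  shows "(\<Sum>j<k. OPT {..n} speeds (doubling_jobs (Suc j)) / 2 ^ j) \<ge> 5 * real k - 2"
proof -
  \<comment> \<open>The losses \<open>(1/2) ^ j\<close> against 5 total less than 2, so they stay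
    bounded as \<open>k\<close> grows.\<close>
  have "5 * real k - 2 \<le> 5 * real k - (\<Sum>j<k. (1/2) ^ j)"
    by (simp add: sum_gp_strict)
  also have "\<dots> = (\<Sum>j<k. (5 * 2 ^ j - 1) / 2 ^ j)"
    by (simp add: diff_divide_distrib sum_subtractf power_one_over)
  also have "\<dots> \<le> (\<Sum>j<k. OPT {..n} speeds (doubling_jobs (Suc j)) / 2 ^ j)"
    using assms by (intro sum_mono divide_right_mono OPT_doubling_jobs_ge) auto
  finally show ?thesis .
qed

lemma competitive_ratio_le:
  assumes "randomized_online_algorithm M A" "machine_park V s" "job_sequence ws"
  shows "competitive_ratio M A \<le> expected_value M A V s ws / OPT V s ws"
  unfolding competitive_ratio_def
proof (rule cInf_lower)
  \<comment> \<open>An infimum of reals is a lower bound only if the set is bounded below; 0 serves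
    here.\<close>
  have "expected_value M A V s ws / OPT V s ws \<ge> 0"
    if "machine_park V s" "job_sequence ws" for V s ws
    using that unfolding expected_value_def job_sequence_def
    by (intro divide_nonneg_nonneg OPT_nonneg Bochner_Integration.integral_nonneg
        assignment_value_nonneg) auto
  then show "bdd_below {expected_value M A V s ws / OPT V s ws | V s ws.
      machine_park V s \<and> job_sequence ws}"
    by (intro bdd_belowI[of _ 0]) auto
qed (use assms in auto)

theorem theorem11:
  fixes M :: "'r measure"
    and A :: "'r \<Rightarrow> nat online_algorithm"
    and \<epsilon> :: real
  assumes "\<epsilon> > 0"
    and "randomized_online_algorithm M A"
  shows "competitive_ratio M A \<le> 0.8 + \<epsilon> \<and>
    (\<exists>V s ws. machine_park V s \<and> job_sequence ws \<and>
       expected_value M A V s ws \<le> (0.8 + \<epsilon>) * OPT V s ws)"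
proof -
  \<comment> \<open>\<open>n\<close> is both the number of slow machines and the number of stopping
    times. The surplus 5 * \<epsilon> * n must exceed the bounded loss 1.6 + 2 * \<epsilon>; this
    choice makes it exceed 6 + 2 * \<epsilon>.\<close>
  obtain n :: nat where n: "real n > 2 / \<epsilon>" using reals_Archimedean2 by blast
  define E where "E j = expected_value M A {..n} speeds (doubling_jobs (Suc j))" for j
  define P where "P j = OPT {..n} speeds (doubling_jobs (Suc j))" for j
  have "n > 0" using n assms(1) by (cases n) (auto simp: field_simps)
  \<comment> \<open>Failure at every stopping time, summed with weights \<open>1 / 2 ^ j\<close>,
    would contradict the two summed bounds. Since \<open>E\<close> is already averaged over seeds,
    the \<open>j\<close> found is independent of the seed.\<close>
  have "\<exists>j<n. E j \<le> (0.8 + \<epsilon>) * P j"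
  proof (rule ccontr)
    assume "\<not> ?thesis"
    then have "(\<Sum>j<n. (0.8 + \<epsilon>) * P j / 2 ^ j) < (\<Sum>j<n. E j / 2 ^ j)"
      using \<open>n > 0\<close> by (intro sum_strict_mono divide_strict_right_mono) (auto simp: not_le)
    also have "\<dots> \<le> 4 * real n"
      unfolding E_def by (rule expected_value_doubling_jobs_sum[OF assms(2)])
    finally have "(0.8 + \<epsilon>) * (\<Sum>j<n. P j / 2 ^ j) < 4 * real n"
      by (simp only: sum_distrib_left times_divide_eq_right)
    moreover have "(0.8 + \<epsilon>) * (5 * real n - 2) \<le> (0.8 + \<epsilon>) * (\<Sum>j<n. P j / 2 ^ j)"
      using assms(1) unfolding P_def by (intro mult_left_mono OPT_doubling_jobs_sum) auto
    moreover have "\<epsilon> * real n > 2" using n assms(1) by (simp add: field_simps)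
    moreover have "\<epsilon> * real n \<ge> \<epsilon>" using \<open>n > 0\<close> assms(1) by simp
    ultimately show False by (simp add: algebra_simps)
  qed
  then obtain j where j: "j < n" "E j \<le> (0.8 + \<epsilon>) * P j" by blast
  have "P j \<ge> 5 * 2 ^ j - 1" unfolding P_def using j by (intro OPT_doubling_jobs_ge) simp
  moreover have "(2::real) ^ j \<ge> 1" by simp
  ultimately have "P j > 0" by linarith
  have "competitive_ratio M A \<le> E j / P j"
    unfolding E_def P_def
    by (intro competitive_ratio_le assms machine_park_speeds job_sequence_doubling_jobs)
  also have "\<dots> \<le> 0.8 + \<epsilon>" using j \<open>P j > 0\<close> by (simp add: pos_divide_le_eq)
  finally show ?thesis
    using j machine_park_speeds job_sequence_doubling_jobs unfolding E_def P_def by blast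
qed

end
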